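(* Let $q$ be a prime power and $n$ an odd integer with $\gcd(n,\,q(q^2-1))=1$. Let $F=\mathbb{F}_q$, $E=\mathbb{F}_{q^n}$, regarded as an $n$-dimensional $F$-vector space (so that $2$-dimensional $F$-subspaces of $E$ correspond to elements of the Grassmannian $G_q(2,n)$ of $2$-dimensional subspaces of $\mathbb{F}_q^n$). Let $\Gamma=E^\times/F^\times$ and let $\alpha\in E^\times$ be an element whose image generates the cyclic group $\Gamma$ (e.g. a primitive element of $E$, a root of a primitive polynomial). Let $\mathcal{C}=(E\setminus F)/\mathrm{PGL}_2(F)$ be the set of orbits of the Möbius action $\begin{pmatrix}a&b\\c&d\end{pmatrix}\cdot z=\frac{az+b}{cz+d}$ of $\mathrm{PGL}_2(F)$ on $E\setminus F$ (the "projective ratio classes"); write $[z]$ for the class of $z$. The Frobenius $\sigma(z)=z^q$ permutes $\mathcal{C}$; partition $\mathcal{C}$ into its $\sigma$-orbits $$\mathcal{C}=C_1\sqcup\cdots\sqcup C_m,\qquad C_i=\{[g_i],[g_i^{q}],[g_i^{q^2}],\dots,[g_i^{q^{n-1}}]\},$$ with representatives $g_1,\dots,g_m\in E\setminus F$, where $g_1$ is chosen so that $\alpha g_1=\gamma\cdot g_1$ for some $\gamma\in\mathrm{PGL}_2(F)$ (for instance $g_1=1/(\alpha-1)$, for which $\begin{pmatrix}1&1\\0&1\end{pmatrix}\cdot g_1=\alpha g_1$). Let $c_1,\dots,c_r$ be the elements $$\{\alpha g_1,\,g_1^{q},\,g_1^{q^2},\dots,g_1^{q^{n-1}}\}\ \sqcup\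 \bigsqcup_{i=2}^{m}\{g_i,\,g_i^{q},\dots,g_i^{q^{n-1}}\}$$ listed in any order (so $r=mn$). Extend the indices of $c_i$ periodically modulo $r$, and define $$\beta_0:=1,\qquad \beta_i:=c_1c_2\cdots c_i\ (i\ge 1),\qquad W_i:=\mathrm{span}_F\{\beta_i,\beta_{i-1}\}\ (i\ge1).$$ Then $(W_i)_{i\ge1}$ is a universal cycle on $G_q(2,n)$: with $N=|G_q(2,n)|$, the subspaces $W_1,\dots,W_N$ are pairwise distinct $2$-dimensional $F$-subspaces of $E$ and every $2$-dimensional $F$-subspace of $E$ occurs among them exactly once, $W_{i+N}=W_i$ for all $i$; moreover the sequence has the periodicity $W_{i+r}=\alpha\cdot W_i$ for all $i\ge1$.
   Context: $G_q(2,n)$ denotes the set of $2$-dimensional $\mathbb{F}_q$-subspaces of $\mathbb{F}_q^n$, and $|G_q(2,n)|=\frac{(q^n-1)(q^n-q)}{(q^2-1)(q^2-q)}$. For $x\in E^\times$ and a subspace $W\subseteq E$, $x\cdot W=\{xw:w\in W\}$. A universal cycle on $G_q(2,n)$ is a cyclic sequence of vectors $\beta_0,\beta_1,\dots$ in which the spans of consecutive pairs $\{\beta_{i-1},\beta_i\}$ run through every element of $G_q(2,n)$ exactly once per period.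
   Formalization: The displayed collection of elements is read as a set without repetitions and r is its size; "so r = mn" is stated only for prime n, since for composite n some g_i lies in a proper intermediate field and r < mn (e.g. q=2, n=25). *)

theory Defs
  imports
    "HOL-Analysis.Cartesian_Space"
    "HOL-Algebra.Group_Action"
    "HOL-Algebra.Generated_Groups"
    "HOL-Algebra.Multiplicative_Group"
    "HOL-Algebra.Algebraic_Closure_Type"
    "HOL-Number_Theory.Prime_Powers"
begin

text \<open>
  A field extension E/F is given by two field types and a ring homomorphism \<open>emb\<close> from F to E
  (automatically injective). The subfield F of E is \<open>range emb\<close>, and E is an F-vector space
  through the scalar multiplication below.
\<close>

definition ext_scale :: "('f::field \<Rightarrow> 'e::field) \<Rightarrow> 'f \<Rightarrow> 'e \<Rightarrow> 'e" where
  "ext_scale emb a x = emb a * x"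

lemma vector_space_ext_scale:
  fixes emb :: "'f::field \<Rightarrow> 'e::field"
  assumes "emb \<in> ring_hom ring_of_type_algebra ring_of_type_algebra"
  shows "vector_space (ext_scale emb)"
  using assms
  by unfold_locales
    (auto simp: ring_hom_def ring_of_type_algebra_def ext_scale_def algebra_simps)

definition grassmannian :: "('f::field \<Rightarrow> 'e::field) \<Rightarrow> nat \<Rightarrow> 'e set set" where
  "grassmannian emb k =
     {W. module.subspace (ext_scale emb) W \<and> vector_space.dim (ext_scale emb) W = k}"

definition unit_quotient :: "('f::field \<Rightarrow> 'e::field) \<Rightarrow> 'e set monoid" where
  "unit_quotient emb = mult_of ring_of_type_algebra Mod (emb ` (UNIV - {0}))"

definition unit_class :: "('f::field \<Rightarrow> 'e::field) \<Rightarrow> 'e \<Rightarrow> 'e set" where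
  "unit_class emb x = (emb ` (UNIV - {0})) #>\<^bsub>mult_of ring_of_type_algebra\<^esub> x"

definition GL2 :: "('f::field ^ 2 ^ 2) monoid" where
  "GL2 = \<lparr>carrier = {A. invertible A}, monoid.mult = (**), one = mat 1\<rparr>"

definition PGL2 :: "('f::field ^ 2 ^ 2) set monoid" where
  "PGL2 = GL2 Mod {mat a | a. a \<noteq> 0}"

definition moebius :: "('f::field \<Rightarrow> 'e::field) \<Rightarrow> 'f ^ 2 ^ 2 \<Rightarrow> 'e \<Rightarrow> 'e" where
  "moebius emb A z =
     (emb (A $ 1 $ 1) * z + emb (A $ 1 $ 2)) / (emb (A $ 2 $ 1) * z + emb (A $ 2 $ 2))"

text \<open>
  An element of PGL2 is a set of proportional matrices. They all act in the same way, and the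
  description below picks out the common value. For z outside \<open>range emb\<close> the denominator of an
  invertible matrix never vanishes.
\<close>

definition pgl_act :: "('f::field \<Rightarrow> 'e::field) \<Rightarrow> ('f ^ 2 ^ 2) set \<Rightarrow> 'e \<Rightarrow> 'e" where
  "pgl_act emb P z = (THE w. \<forall>A\<in>P. moebius emb A z = w)"

lemma pgl_act_coset:
  fixes emb :: "'f::field \<Rightarrow> 'e::field"
  assumes emb: "emb \<in> ring_hom ring_of_type_algebra ring_of_type_algebra"
  shows "pgl_act emb ({mat a | a. a \<noteq> 0} #>\<^bsub>GL2\<^esub> A) z = moebius emb A z"
proof -
  have mult: "emb (x * y) = emb x * emb y" and one: "emb 1 = 1" for x y
    using emb by (auto simp: ring_hom_def ring_of_type_algebra_def)
  have entry: "(mat a ** A) $ i $ j = a * A $ i $ j" for a i j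
  proof -
    have "(mat a ** A) $ i $ j = (\<Sum>k\<in>UNIV. (if i = k then a * A $ k $ j else 0))"
      by (simp add: matrix_matrix_mult_def mat_def if_distrib[of "\<lambda>x. x * _"] cong: if_cong)
    then show ?thesis by simp
  qed
  have scale: "moebius emb (mat a ** A) z = moebius emb A z" if "a \<noteq> 0" for a
  proof -
    have "emb a * emb (inverse a) = 1"
      using that by (simp add: mult[symmetric] one)
    then have "emb a \<noteq> 0" by auto
    moreover have "moebius emb (mat a ** A) z =
        (emb a * (emb (A $ 1 $ 1) * z + emb (A $ 1 $ 2)))
          / (emb a * (emb (A $ 2 $ 1) * z + emb (A $ 2 $ 2)))"
      by (simp add: moebius_def entry mult algebra_simps)
    ultimately show ?thesis by (simp add: moebius_def)
  qed
  have coset: "{mat a | a. a \<noteq> 0} #>\<^bsub>GL2\<^esub> A = {mat a ** A | a. a \<noteq> 0}"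
    by (auto simp: r_coset_def GL2_def)
  have "\<exists>a::'f. a \<noteq> 0"
    using zero_neq_one by metis
  then have "(\<forall>B\<in>{mat a ** A | a. a \<noteq> 0}. moebius emb B z = w) \<longleftrightarrow> w = moebius emb A z" for w
    using scale by fastforce
  then show ?thesis
    unfolding pgl_act_def coset by simp
qed

definition ratio_class :: "('f::field \<Rightarrow> 'e::field) \<Rightarrow> 'e \<Rightarrow> 'e set" where
  "ratio_class emb z = orbit PGL2 (pgl_act emb) z"

definition ratio_classes :: "('f::field \<Rightarrow> 'e::field) \<Rightarrow> 'e set set" where
  "ratio_classes emb = orbits PGL2 (UNIV - range emb) (pgl_act emb)"

text \<open>
  The conjugates of z, and their ratio classes, are sets: when z lies in a proper intermediate
  field, the powers of Frobenius repeat and there are fewer than n of them.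
\<close>

definition conjugates :: "nat \<Rightarrow> nat \<Rightarrow> 'e::field \<Rightarrow> 'e set" where
  "conjugates q n z = (\<lambda>k. z ^ (q ^ k)) ` {..<n}"

definition frobenius_orbit :: "('f::field \<Rightarrow> 'e::field) \<Rightarrow> nat \<Rightarrow> nat \<Rightarrow> 'e \<Rightarrow> 'e set set" where
  "frobenius_orbit emb q n z = (\<lambda>k. ratio_class emb (z ^ (q ^ k))) ` {..<n}"

text \<open>Only the indices \<open>i \<ge> 1\<close> are meaningful here and in the next definition.\<close>

definition consecutive_span :: "('f::field \<Rightarrow> 'e::field) \<Rightarrow> (nat \<Rightarrow> 'e) \<Rightarrow> nat \<Rightarrow> 'e set" where
  "consecutive_span emb \<beta> i = module.span (ext_scale emb) {\<beta> i, \<beta> (i - 1)}"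

text \<open>
  The vectors themselves need not be periodic, only the spans of consecutive pairs are required
  to be.
\<close>

definition universal_cycle :: "('f::field \<Rightarrow> 'e::field) \<Rightarrow> (nat \<Rightarrow> 'e) \<Rightarrow> bool" where
  "universal_cycle emb \<beta> \<longleftrightarrow>
     (let N = card (grassmannian emb 2); W = consecutive_span emb \<beta>
      in bij_betw W {1..N} (grassmannian emb 2) \<and> (\<forall>i\<ge>1. W (i + N) = W i))"

end

theory Submission
  imports
    Defs
    "HOL-Number_Theory.Residues"
    "HOL-Analysis.Determinants"
begin

text \<open>
  For \<open>z \<notin> F\<close> the plane spanned by \<open>z\<close> and \<open>1\<close> has stabilizer \<open>F\<^sup>\<times>\<close> in \<open>E\<^sup>\<times>\<close>, because \<open>n\<close> is odd
  and so no element of \<open>E\<close> is quadratic over \<open>F\<close>. Two such planes are \<open>E\<^sup>\<times>\<close>-multiples of each other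
  iff the ratio classes agree, so the 2-dimensional subspaces are parametrized by a ratio class and
  an element of \<open>\<Gamma> = E\<^sup>\<times>/F\<^sup>\<times>\<close>. As \<open>n\<close> is coprime to the order of \<open>PGL\<^sub>2(F)\<close>, distinct conjugates of an
  element lie in distinct classes; hence the multipliers \<open>c\<^sub>1, \<dots>, c\<^sub>r\<close> represent every class exactly
  once. Their product is \<open>\<alpha>\<close> times norms, that is, \<open>\<alpha>\<close> up to a factor in \<open>F\<^sup>\<times>\<close>. So each block of \<open>r\<close>
  consecutive planes meets every class once, and the next block is its translate by \<open>\<alpha>\<close>, a
  generator of \<open>\<Gamma>\<close>.
\<close>

section \<open>Fixed points of power maps in finite fields\<close>

text \<open>
  The library fact \<open>finite_field_power_card_eq_same\<close> needs the class \<open>finite_field\<close>, which is not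
  inferred from the sort \<open>{field, finite}\<close>.
\<close>

lemma finite_field_power_card:
  fixes x :: "'a::{field,finite}"
  shows "x ^ CARD('a) = x"
proof (cases "x = 0")
  case False
  have "\<Prod>(UNIV - {0}) = (\<Prod>y\<in>UNIV - {0}. x * y)"
    by (rule prod.reindex_bij_witness[of _ "\<lambda>y. x * y" "\<lambda>y. y / x"]) (use False in auto)
  also have "\<dots> = x ^ (CARD('a) - 1) * \<Prod>(UNIV - {0})"
    by (simp add: prod.distrib card_Diff_singleton)
  finally have "x ^ (CARD('a) - 1) = 1"
    by simp
  then show ?thesis
    by (metis mult.right_neutral power_eq_if zero_less_card_finite less_numeral_extra(3))
qed simp

text \<open>The fixed points are roots of X^k - X, whose leading term survives because k >
  1.\<close>

lemma card_power_fixed_points_le: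
  assumes "k > 1"
  shows "card {x::'a::idom. x ^ k = x} \<le> k"
proof -
  define p :: "'a poly" where "p = monom 1 k - monom 1 1"
  have "coeff p k = 1"
    using assms by (simp add: p_def)
  then have "p \<noteq> 0"
    by auto
  then have "card {x. poly p x = 0} \<le> degree p"
    by (rule card_poly_roots_bound)
  also have "degree p \<le> k"
    unfolding p_def using assms by (intro degree_diff_le) (auto intro: order.trans[OF degree_monom_le])
  finally show ?thesis
    by (simp add: p_def poly_monom)
qed

section \<open>The extension E/F and its Frobenius powers\<close>

locale finite_field_ext =
  fixes emb :: "'f::{field,finite} \<Rightarrow> 'e::{field,finite}" and q n :: nat
  assumes primepow_q: "primepow q"
    and odd_n: "odd n"
    and coprime_n: "coprime n (q * (q ^ 2 - 1))"
    and card_F: "CARD('f) = q"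
    and card_E: "CARD('e) = q ^ n"
    and emb_hom: "emb \<in> ring_hom ring_of_type_algebra ring_of_type_algebra"
begin

lemma emb_add [simp]: "emb (x + y) = emb x + emb y"
  and emb_mult [simp]: "emb (x * y) = emb x * emb y"
  and emb_1 [simp]: "emb 1 = 1"
  using emb_hom by (auto simp: ring_hom_def ring_of_type_algebra_def)

lemma emb_0 [simp]: "emb 0 = 0"
  using emb_add[of 0 0] by (metis add_0 add_cancel_left_left)

lemma emb_uminus [simp]: "emb (- x) = - emb x"
  using emb_add[of x "- x"] by (simp add: eq_neg_iff_add_eq_0 add.commute)

lemma emb_diff [simp]: "emb (x - y) = emb x - emb y"
  using emb_add[of x "- y"] by simp

lemma emb_eq_0_iff [simp]: "emb x = 0 \<longleftrightarrow> x = 0"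
proof
  assume "emb x = 0"
  then have "emb (x * inverse x) = 0" by simp
  then show "x = 0" by (cases "x = 0") (auto simp del: emb_mult)
qed simp

lemma emb_eq_iff [simp]: "emb x = emb y \<longleftrightarrow> x = y"
  using emb_eq_0_iff[of "x - y"] by simp

lemma emb_inverse [simp]: "emb (inverse x) = inverse (emb x)"
proof (cases "x = 0")
  case False
  then have "emb x * emb (inverse x) = 1"
    by (simp flip: emb_mult)
  then show ?thesis
    by (metis inverse_unique)
qed simp

lemma emb_divide [simp]: "emb (x / y) = emb x / emb y"
  by (simp add: divide_inverse)

lemma emb_power [simp]: "emb (x ^ k) = emb x ^ k"
  by (induction k) auto

lemma q_gt_1: "q > 1"
  using primepow_gt_Suc_0[OF primepow_q] by simp

lemma n_pos: "n > 0"
  using odd_n by (rule odd_pos)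

text \<open>Makes the freshman's dream available: the characteristic divides q^n, so it is the prime
  of which q is a power.\<close>

lemma q_power_CHAR: obtains k where "q = CHAR('e) ^ k" "prime CHAR('e)"
proof -
  have prime: "prime CHAR('e)"
    by (intro prime_CHAR_semidom finite_imp_CHAR_pos) simp
  obtain p k where pk: "prime p" "q = p ^ k"
    using primepow_q by (auto simp: primepow_def)
  have "CHAR('e) dvd q ^ n"
    using CHAR_dvd_CARD card_E by metis
  then have "CHAR('e) dvd p"
    using prime pk(2) prime_dvd_power by blast
  then have "CHAR('e) = p"
    using prime pk(1) primes_dvd_imp_eq by blast
  with that pk prime show ?thesis by blast
qed

lemma frob_add: "(x + y :: 'e) ^ (q ^ k) = x ^ (q ^ k) + y ^ (q ^ k)"
proof -
  obtain l where "q = CHAR('e) ^ l" "prime CHAR('e)"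
    by (rule q_power_CHAR)
  then show ?thesis
    by (simp add: freshmans_dream' power_mult[symmetric])
qed

lemma frob_power_add: "(x :: 'e) ^ (q ^ (k + l)) = (x ^ (q ^ k)) ^ (q ^ l)"
  by (simp add: power_add power_mult)

lemma frob_emb [simp]: "emb a ^ (q ^ k) = emb a"
proof (induction k)
  case (Suc k)
  have "emb a ^ q = emb a"
    using finite_field_power_card[of a] card_F by (simp flip: emb_power)
  with Suc show ?case
    by (simp add: power_mult)
qed simp

text \<open>F supplies q roots of X^q - X, and there cannot be more.\<close>

lemma in_F_iff: "x \<in> range emb \<longleftrightarrow> x ^ q = x"
proof -
  have "card (range emb) = q"
    using card_F by (simp add: card_image inj_def)
  moreover have "card {x::'e. x ^ q = x} \<le> q"
    using q_gt_1 by (rule card_power_fixed_points_le)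
  moreover have "range emb \<subseteq> {x. x ^ q = x}"
    using frob_emb[of _ 1] by auto
  ultimately have "range emb = {x. x ^ q = x}"
    by (intro card_seteq) auto
  then show ?thesis by auto
qed

lemma frob_fixed_mult: "(x :: 'e) ^ (q ^ k) = x \<Longrightarrow> x ^ (q ^ (k * j)) = x"
  by (induction j) (simp_all add: frob_power_add)

lemma frob_n: "(x :: 'e) ^ (q ^ n) = x"
  using finite_field_power_card[of x] card_E by simp

text \<open>After k steps of Frobenius, another n * k - k steps complete a multiple of n and restore
  the element.\<close>

lemma frob_inj: "(x :: 'e) ^ (q ^ k) = y ^ (q ^ k) \<longleftrightarrow> x = y"
proof
  assume eq: "x ^ (q ^ k) = y ^ (q ^ k)"
  have "n * k = k + (n * k - k)"
    using n_pos by simp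
  then have "(z ^ (q ^ k)) ^ (q ^ (n * k - k)) = z" for z :: 'e
    using frob_fixed_mult[OF frob_n, of z k] frob_power_add[of z k "n * k - k"] by simp
  then show "x = y"
    using eq by metis
qed simp

text \<open>By Bezout over the naturals, a * u = b * v + gcd a b; the exponents a * u and b * v both
  fix x, hence so does the gcd.\<close>

lemma frob_gcd:
  assumes "(x :: 'e) ^ (q ^ a) = x" "x ^ (q ^ b) = x"
  shows "x ^ (q ^ gcd a b) = x"
proof (cases "a = 0")
  case False
  then obtain u v where "a * u = b * v + gcd a b"
    using bezout_nat by blast
  then show ?thesis
    using frob_fixed_mult[OF assms(1), of u] frob_fixed_mult[OF assms(2), of v]
    by (simp add: frob_power_add)
qed (use assms in simp)

lemma frob_diff:
  assumes "(x :: 'e) ^ (q ^ a) = x ^ (q ^ b)" "a \<le> b"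
  shows "x ^ (q ^ (b - a)) = x"
proof -
  have "(x ^ (q ^ (b - a))) ^ (q ^ a) = x ^ (q ^ a)"
    using assms by (simp flip: frob_power_add)
  then show ?thesis
    by (simp add: frob_inj)
qed

text \<open>If a is nonzero, z and z^q are the two roots of a quadratic over F, so their sum lies in
  F and the square of Frobenius fixes z. As n is odd, Frobenius itself then fixes z, which puts z in
  F.\<close>

lemma no_quadratic:
  assumes z: "z \<notin> range emb" and eq: "emb a * z ^ 2 + emb b * z + emb c = 0"
  shows "a = 0 \<and> b = 0 \<and> c = 0"
proof (cases "a = 0")
  case True
  show ?thesis
  proof (cases "b = 0")
    case False
    then have "z = emb (- c / b)"
      using eq True by (simp add: field_simps eq_neg_iff_add_eq_0)
    with z show ?thesis by blast
  qed (use eq True in simp)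
next
  case False
  let ?w = "z ^ q"
  have "emb a * ?w ^ 2 + emb b * ?w + emb c = (emb a * z ^ 2 + emb b * z + emb c) ^ (q ^ 1)"
    unfolding frob_add power_mult_distrib frob_emb by (simp add: mult.commute flip: power_mult)
  also have "\<dots> = 0"
    using q_gt_1 by (simp add: eq)
  \<comment> \<open>The difference of the two equations has the nonzero factor
    \<open>?w - z\<close>; cancelling it leaves the sum of the roots.\<close>
  finally have "(emb a * ?w ^ 2 + emb b * ?w + emb c) - (emb a * z ^ 2 + emb b * z + emb c) = 0"
    using eq by simp
  then have "(?w - z) * (emb a * (?w + z) + emb b) = 0"
    by (simp add: algebra_simps power2_eq_square)
  moreover have "?w \<noteq> z"
    using z in_F_iff by blast
  ultimately have "emb a * (?w + z) + emb b = 0"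
    by simp
  then have sum: "?w + z = emb (- b / a)"
    using False by (simp add: field_simps eq_neg_iff_add_eq_0)
  then have "(?w + z) ^ (q ^ 1) = ?w + z"
    using frob_emb by metis
  then have "z ^ (q ^ 2) = z"
    unfolding frob_add by (simp add: power2_eq_square power_mult)
  then have "z ^ (q ^ gcd 2 n) = z"
    using frob_gcd frob_n by blast
  then have "z ^ q = z"
    using odd_n by (simp add: coprime_iff_gcd_eq_1[symmetric])
  with \<open>?w \<noteq> z\<close> show ?thesis by simp
qed

section \<open>Planes spanned by z and 1\<close>

text \<open>Written as an image of F x F so that elements and cardinality are explicit;
  \<open>span_pair\<close> makes the link to linear spans.\<close>

definition plane :: "'e \<Rightarrow> 'e set" where
  "plane z = (\<lambda>(a, b). emb a * z + emb b) ` UNIV"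

lemma mem_planeI [intro]: "emb a * z + emb b \<in> plane z"
  unfolding plane_def by (rule image_eqI[of _ _ "(a, b)"]) auto

lemma mem_planeE:
  assumes "x \<in> plane z"
  obtains a b where "x = emb a * z + emb b"
  using assms unfolding plane_def by auto

lemma self_mem_plane: "z \<in> plane z"
  using mem_planeI[of 1 z 0] by simp

lemma one_mem_plane: "1 \<in> plane z"
  using mem_planeI[of 0 z 1] by simp

lemma linear_eq_0_iff:
  "z \<notin> range emb \<Longrightarrow> emb c * z + emb d = 0 \<longleftrightarrow> c = 0 \<and> d = 0"
  using no_quadratic[of z 0 c d] by auto

lemma linear_eq_iff:
  assumes "z \<notin> range emb"
  shows "emb a * z + emb b = emb c * z + emb d \<longleftrightarrow> a = c \<and> b = d"
proof -
  have "emb a * z + emb b = emb c * z + emb d \<longleftrightarrow> emb (a - c) * z + emb (b - d) = 0"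
    by (simp add: algebra_simps)
  then show ?thesis
    by (simp only: linear_eq_0_iff[OF assms]) auto
qed

lemma card_plane:
  assumes "z \<notin> range emb"
  shows "card (plane z) = q ^ 2"
proof -
  have "inj (\<lambda>(a, b). emb a * z + emb b)"
    by (rule injI) (auto simp: linear_eq_iff[OF assms])
  then show ?thesis
    by (simp add: plane_def card_image card_F power2_eq_square)
qed

text \<open>Since 1 and z lie in the plane, so do x = a z + b and x z. Expressing x z through z and
  1 gives a quadratic relation for z with leading coefficient a, so a = 0.\<close>

lemma plane_stabilizer:
  assumes z: "z \<notin> range emb" and x: "(*) x ` plane z = plane z"
  shows "x \<in> range emb"
proof -
  have "x \<in> plane z"
    using imageI[OF one_mem_plane[of z], of "(*) x"] x by simp
  then obtain a b where ab: "x = emb a * z + emb b"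
    by (rule mem_planeE)
  have "x * z \<in> plane z"
    using imageI[OF self_mem_plane[of z], of "(*) x"] x by simp
  then obtain c d where "x * z = emb c * z + emb d"
    by (rule mem_planeE)
  then have "emb a * z ^ 2 + emb (b - c) * z + emb (- d) = 0"
    by (simp add: ab power2_eq_square algebra_simps)
  then have "a = 0"
    using no_quadratic[OF z] by blast
  with ab show ?thesis by simp
qed

section \<open>Ratio classes and proportional planes\<close>

text \<open>Replaces cosets by matrices: by \<open>pgl_act_coset\<close> any representative computes
  the action.\<close>

lemma mem_ratio_class_iff:
  "w \<in> ratio_class emb z \<longleftrightarrow>
     (\<exists>a b c d. a * d - b * c \<noteq> 0 \<and> w = (emb a * z + emb b) / (emb c * z + emb d))"
proof -
  have "carrier PGL2 = (\<lambda>A::'f^2^2. {mat a | a. a \<noteq> 0} #>\<^bsub>GL2\<^esub> A) ` {A. invertible A}"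
    by (auto simp: PGL2_def FactGroup_def RCOSETS_def GL2_def)
  then have "ratio_class emb z = (\<lambda>A. moebius emb A z) ` {A. invertible A}"
    unfolding ratio_class_def orbit_def
    by (simp add: Setcompr_eq_image image_image pgl_act_coset[OF emb_hom])
  then have "w \<in> ratio_class emb z \<longleftrightarrow> (\<exists>A. invertible A \<and> w = moebius emb A z)"
    by auto
  also have "\<dots> \<longleftrightarrow> (\<exists>A. det A \<noteq> 0 \<and> w = moebius emb A z)"
    by (simp add: invertible_det_nz)
  also have "\<dots> \<longleftrightarrow> (\<exists>a b c d. a * d - b * c \<noteq> 0 \<and> w = (emb a * z + emb b) / (emb c * z + emb d))"
    (is "?L \<longleftrightarrow> ?R")
  proof
    assume ?R
    then obtain a b c d where "a * d - b * c \<noteq> 0" "w = (emb a * z + emb b) / (emb c * z + emb d)"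
      by blast
    then show ?L
      by (intro exI[of _ "vector [vector [a, b], vector [c, d]]"])
        (simp add: det_2 moebius_def vector_2)
  qed (unfold det_2 moebius_def, blast)
  finally show ?thesis .
qed

text \<open>If v is the denominator of the fraction w, then v w and v lie in \<open>plane z\<close>,
  so v times \<open>plane w\<close> is contained in it, and counting gives equality. Conversely, the
  elements of \<open>plane z\<close> that x carries to w and 1 serve as numerator and
  denominator.\<close>

lemma ratio_class_plane_iff:
  assumes z: "z \<notin> range emb"
  shows "w \<in> ratio_class emb z \<longleftrightarrow> w \<notin> range emb \<and> (\<exists>x. x \<noteq> 0 \<and> plane w = (*) x ` plane z)"
    (is "?L \<longleftrightarrow> ?R")
proof
  assume ?L
  then obtain a b c d where det: "a * d - b * c \<noteq> 0"
    and w: "w = (emb a * z + emb b) / (emb c * z + emb d)"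
    by (auto simp: mem_ratio_class_iff)
  define v where "v = emb c * z + emb d"
  have v: "v \<noteq> 0"
    using det linear_eq_0_iff[OF z] by (auto simp: v_def)
  have wv: "w * v = emb a * z + emb b"
    using v by (simp add: w v_def)
  \<comment> \<open>A value in F would make the rows of the matrix proportional.\<close>
  have w_notin: "w \<notin> range emb"
  proof
    assume "w \<in> range emb"
    then obtain e where "w = emb e" by blast
    then have "emb (e * c) * z + emb (e * d) = emb a * z + emb b"
      using wv by (simp add: v_def algebra_simps)
    then have "e * c = a" "e * d = b"
      using linear_eq_iff[OF z, of "e * c" "e * d" a b] by auto
    with det show False by (simp add: mult.left_commute mult.commute flip: \<open>e * c = a\<close> \<open>e * d = b\<close>)
  qed
  have "plane w \<subseteq> (*) (inverse v) ` plane z"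
  proof
    fix y assume "y \<in> plane w"
    then obtain e f where "y = emb e * w + emb f" by (rule mem_planeE)
    then have "v * y = emb e * (w * v) + emb f * v"
      by (simp add: algebra_simps)
    also have "\<dots> = emb (e * a + f * c) * z + emb (e * b + f * d)"
      unfolding wv by (simp add: v_def algebra_simps)
    finally have "v * y \<in> plane z" using mem_planeI by metis
    moreover have "y = inverse v * (v * y)" using v by simp
    ultimately show "y \<in> (*) (inverse v) ` plane z" by blast
  qed
  moreover have "card ((*) (inverse v) ` plane z) = card (plane w)"
    using v z w_notin by (simp add: card_image inj_on_def card_plane)
  ultimately have "plane w = (*) (inverse v) ` plane z"
    by (intro card_subset_eq) auto
  with v w_notin show ?R by (metis nonzero_imp_inverse_nonzero)
next
  assume R: ?R
  then obtain x where w: "w \<notin> range emb" and x: "x \<noteq> 0" "plane w = (*) x ` plane z"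
    by blast
  have "w \<in> (*) x ` plane z" "1 \<in> (*) x ` plane z"
    by (simp_all add: self_mem_plane one_mem_plane flip: x(2))
  then obtain a b c d where *: "w = x * (emb a * z + emb b)" "1 = x * (emb c * z + emb d)"
    by (metis imageE mem_planeE)
  then have nz: "emb c * z + emb d \<noteq> 0" by auto
  have "x = 1 / (emb c * z + emb d)"
    using *(2) nz by (simp add: eq_divide_eq)
  then have w_eq: "w = (emb a * z + emb b) / (emb c * z + emb d)"
    by (simp add: *(1))
  \<comment> \<open>If the determinant vanished, w would be a quotient of proportional expressions
    and lie in F.\<close>
  moreover have "a * d - b * c \<noteq> 0"
  proof
    assume det: "a * d - b * c = 0"
    have "w \<in> range emb"
    proof (cases "c = 0")
      case True
      then have "d \<noteq> 0" "a = 0" using det nz by auto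
      then have "w = emb (b / d)" using w_eq True by simp
      then show ?thesis by blast
    next
      case False
      then have "b = a / c * d" using det by (simp add: field_simps)
      then have "emb a * z + emb b = emb (a / c) * (emb c * z + emb d)"
        using False by (simp add: distrib_left)
      then have "w = emb (a / c)" using w_eq nz by simp
      then show ?thesis by blast
    qed
    with w show False by blast
  qed
  ultimately show ?L unfolding mem_ratio_class_iff by blast
qed

lemma ratio_classI:
  assumes "z \<notin> range emb" "w \<notin> range emb" "x \<noteq> 0" "plane w = (*) x ` plane z"
  shows "w \<in> ratio_class emb z"
  using assms(2-) by (auto simp only: ratio_class_plane_iff[OF assms(1)])

lemma ratio_classE:
  assumes "z \<notin> range emb" "w \<in> ratio_class emb z"
  obtains x where "w \<notin> range emb" "x \<noteq> 0" "plane w = (*) x ` plane z"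
  using assms(2) unfolding ratio_class_plane_iff[OF assms(1)] by (elim conjE exE)

lemma ratio_class_self: "z \<notin> range emb \<Longrightarrow> z \<in> ratio_class emb z"
  by (rule ratio_classI[of _ _ 1]) simp_all

lemma ratio_class_sym:
  assumes "z \<notin> range emb" "w \<in> ratio_class emb z"
  shows "z \<in> ratio_class emb w"
proof -
  from assms obtain x where x: "w \<notin> range emb" "x \<noteq> 0" "plane w = (*) x ` plane z"
    by (rule ratio_classE)
  show ?thesis
    by (rule ratio_classI[of _ _ "inverse x"])
      (use assms(1) x in \<open>simp_all add: image_image flip: mult.assoc\<close>)
qed

lemma ratio_class_subset:
  assumes z: "z \<notin> range emb" and w: "w \<in> ratio_class emb z"
  shows "ratio_class emb w \<subseteq> ratio_class emb z"
proof
  fix v assume v: "v \<in> ratio_class emb w"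
  obtain x where x: "w \<notin> range emb" "x \<noteq> 0" "plane w = (*) x ` plane z"
    using z w by (rule ratio_classE)
  obtain y where y: "v \<notin> range emb" "y \<noteq> 0" "plane v = (*) y ` plane w"
    using x(1) v by (rule ratio_classE)
  show "v \<in> ratio_class emb z"
    by (rule ratio_classI[of _ _ "y * x"]) (use z x y in \<open>simp_all add: image_image mult.assoc\<close>)
qed

lemma ratio_class_eq_iff:
  assumes z: "z \<notin> range emb" and w: "w \<notin> range emb"
  shows "ratio_class emb w = ratio_class emb z \<longleftrightarrow> w \<in> ratio_class emb z"
  using ratio_class_self[OF w] ratio_class_subset[OF z] ratio_class_subset[OF w]
    ratio_class_sym[OF z] by blast

text \<open>An element of the class with nonconstant denominator is \<open>a + b / (z + d)\<close> with \<open>b \<noteq> 0\<close>.\<close>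

lemma card_ratio_class:
  assumes z: "z \<notin> range emb"
  shows "card (ratio_class emb z) = q * (q ^ 2 - 1)"
proof -
  \<comment> \<open>\<open>f\<close> lists the values with c = 0 after scaling d to 1,
    \<open>g\<close> those with c scaled to 1; the nonzero entries in \<open>A\<close> and
    \<open>B\<close> express invertibility.\<close>
  define f where "f = (\<lambda>(a, b). emb a * z + emb b)"
  define g where "g = (\<lambda>(a, b, d). emb a + emb b / (z + emb d))"
  define A :: "('f \<times> 'f) set" where "A = (UNIV - {0}) \<times> UNIV"
  define B :: "('f \<times> 'f \<times> 'f) set" where "B = UNIV \<times> (UNIV - {0}) \<times> UNIV"
  have nz: "z + emb d \<noteq> 0" for d
    using linear_eq_0_iff[OF z, of 1 d] by simp
  have "ratio_class emb z = f ` A \<union> g ` B"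
  proof (intro equalityI subsetI)
    fix w assume "w \<in> ratio_class emb z"
    then obtain a b c d where det: "a * d - b * c \<noteq> 0"
      and w: "w = (emb a * z + emb b) / (emb c * z + emb d)"
      by (auto simp: mem_ratio_class_iff)
    show "w \<in> f ` A \<union> g ` B"
    proof (cases "c = 0")
      case True
      then have "w = f (a / d, b / d)" "a / d \<noteq> 0"
        using w det by (auto simp: f_def field_simps)
      then show ?thesis by (auto simp: A_def)
    next
      case False
      define a' b' d' where "a' = a / c" and "b' = b / c" and "d' = d / c"
      have abd: "a = c * a'" "b = c * b'" "d = c * d'"
        using False by (simp_all add: a'_def b'_def d'_def)
      have "w = (emb c * (emb a' * z + emb b')) / (emb c * (z + emb d'))"
        by (simp add: w abd algebra_simps)
      also have "\<dots> = (emb a' * z + emb b') / (z + emb d')"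
        using False by simp
      also have "\<dots> = g (a', b' - a' * d', d')"
        using nz[of d'] by (simp add: g_def field_simps)
      finally have "w = g (a', b' - a' * d', d')" .
      moreover have "b' - a' * d' \<noteq> 0"
        using det by (auto simp: abd algebra_simps)
      ultimately show ?thesis by (auto simp: B_def)
    qed
  next
    fix w assume "w \<in> f ` A \<union> g ` B"
    then show "w \<in> ratio_class emb z"
    proof
      assume "w \<in> f ` A"
      then obtain a b where "a \<noteq> 0" "w = emb a * z + emb b" by (auto simp: A_def f_def)
      then show ?thesis
        unfolding mem_ratio_class_iff by (intro exI[of _ a] exI[of _ b] exI[of _ 0] exI[of _ 1]) simp
    next
      assume "w \<in> g ` B"
      then obtain a b d where "b \<noteq> 0" "w = emb a + emb b / (z + emb d)" by (auto simp: B_def g_def)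
      then show ?thesis
        unfolding mem_ratio_class_iff using nz[of d]
        by (intro exI[of _ a] exI[of _ "a * d + b"] exI[of _ 1] exI[of _ d]) (simp add: field_simps)
    qed
  qed
  moreover have "inj_on f A"
    by (rule inj_onI) (auto simp: f_def linear_eq_iff[OF z])
  \<comment> \<open>Clearing denominators turns an equality of values into a quadratic relation for
    z, whose coefficients must vanish.\<close>
  moreover have "inj_on g B"
  proof (rule inj_onI)
    fix s t assume st: "s \<in> B" "t \<in> B" and eq: "g s = g t"
    obtain a b d where s: "s = (a, b, d)" by (cases s) auto
    obtain a' b' d' where t: "t = (a', b', d')" by (cases t) auto
    have clear: "(s + t / u) * (u * v) = s * (u * v) + t * v" if "u \<noteq> 0" for s t u v :: 'e
      using that by (simp add: distrib_right)
    have "(emb a + emb b / (z + emb d)) * ((z + emb d) * (z + emb d'))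
        = (emb a' + emb b' / (z + emb d')) * ((z + emb d') * (z + emb d))"
      using eq by (simp add: s t g_def mult.commute)
    then have "emb a * ((z + emb d) * (z + emb d')) + emb b * (z + emb d')
        = emb a' * ((z + emb d') * (z + emb d)) + emb b' * (z + emb d)"
      unfolding clear[OF nz] .
    then have "emb (a - a') * z ^ 2 + emb ((a - a') * (d + d') + b - b') * z
        + emb ((a - a') * d * d' + b * d' - b' * d) = 0"
      by (simp add: power2_eq_square algebra_simps)
    then have *: "a - a' = 0 \<and> (a - a') * (d + d') + b - b' = 0 \<and>
        (a - a') * d * d' + b * d' - b' * d = 0"
      by (rule no_quadratic[OF z])
    then have "a = a'" "b = b'" by auto
    with * st show "s = t"
      by (auto simp: s t B_def simp flip: right_diff_distrib)
  qed
  moreover have "f ` A \<inter> g ` B = {}"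
  proof -
    have False if "a \<noteq> 0" "emb a * z + emb b = emb a' + emb b' / (z + emb d)" for a b a' b' d
    proof -
      have "(emb a * z + emb b) * (z + emb d) = emb a' * (z + emb d) + emb b'"
        using that(2) nz[of d] by (simp add: field_simps)
      then have "emb a * z ^ 2 + emb (a * d + b - a') * z + emb (b * d - a' * d - b') = 0"
        by (simp add: power2_eq_square algebra_simps)
      with \<open>a \<noteq> 0\<close> show False using no_quadratic[OF z] by blast
    qed
    then show ?thesis unfolding A_def B_def f_def g_def by fast
  qed
  ultimately have "card (ratio_class emb z) = card A + card B"
    by (simp add: card_Un_disjoint card_image)
  also have "\<dots> = (q - 1) * q + q * ((q - 1) * q)"
    by (simp add: A_def B_def card_cartesian_product card_Diff_singleton card_F)
  also have "\<dots> = q * (q ^ 2 - 1)"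
    using q_gt_1 by (cases q) (simp_all add: power2_eq_square algebra_simps)
  finally show ?thesis .
qed

section \<open>Frobenius on ratio classes\<close>

lemma frob_ratio:
  "((emb a * z + emb b) / (emb c * z + emb d)) ^ (q ^ k) =
     (emb a * z ^ (q ^ k) + emb b) / (emb c * z ^ (q ^ k) + emb d)"
  by (simp add: power_divide frob_add power_mult_distrib)

lemma frob_ratio_class: "w \<in> ratio_class emb z \<Longrightarrow> w ^ (q ^ k) \<in> ratio_class emb (z ^ (q ^ k))"
  unfolding mem_ratio_class_iff using frob_ratio by blast

lemma frob_not_in_F: "z \<notin> range emb \<Longrightarrow> z ^ (q ^ k) \<notin> range emb"
  using frob_emb frob_inj by (metis imageE rangeI)

text \<open>w is a fraction in z with coefficients in F, and these are fixed by every power of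
  Frobenius.\<close>

lemma frob_fixes_ratio_class:
  assumes "w \<in> ratio_class emb z" "z ^ (q ^ k) = z"
  shows "w ^ (q ^ k) = w"
proof -
  obtain a b c d where "w = (emb a * z + emb b) / (emb c * z + emb d)"
    using assms(1) unfolding mem_ratio_class_iff by blast
  with assms(2) show ?thesis
    by (simp only: frob_ratio)
qed

text \<open>
  A power of Frobenius that maps the class of \<open>z\<close> to itself commutes with the free action of
  \<open>PGL\<^sub>2(F)\<close>, so all its cycles on the class have the same length \<open>d\<close>. This \<open>d\<close> divides both \<open>n\<close>
  and the size \<open>q (q\<^sup>2 - 1)\<close> of the class.
\<close>

lemma conjugate_in_ratio_class:
  assumes z: "z \<notin> range emb" and k: "z ^ (q ^ k) \<in> ratio_class emb z"
  shows "z ^ (q ^ k) = z"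
proof -
  let ?O = "ratio_class emb z"
  have closed: "w ^ (q ^ (k * j)) \<in> ?O" if "w \<in> ?O" for w j
  proof (induction j)
    case (Suc j)
    then have "(w ^ (q ^ (k * j))) ^ (q ^ k) \<in> ratio_class emb (z ^ (q ^ k))"
      by (rule frob_ratio_class)
    also have "\<dots> \<subseteq> ?O"
      using z k by (rule ratio_class_subset)
    finally show ?case
      by (simp add: frob_power_add[symmetric] add.commute)
  qed (use that in simp)
  have fixed_iff: "w ^ (q ^ j) = w \<longleftrightarrow> z ^ (q ^ j) = z" if "w \<in> ?O" for w j
    using frob_fixes_ratio_class[OF that] frob_fixes_ratio_class[OF ratio_class_sym[OF z that]]
    by blast
  \<comment> \<open>The cycle length of z under the k-th power of Frobenius; by
    \<open>fixed_iff\<close> it is the cycle length of every element of the class.\<close>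
  define d where "d = (LEAST d. d > 0 \<and> z ^ (q ^ (k * d)) = z)"
  have "\<exists>d. d > 0 \<and> z ^ (q ^ (k * d)) = z"
    using n_pos frob_fixed_mult[OF frob_n, of z k] by (metis mult.commute)
  then have d: "d > 0" "z ^ (q ^ (k * d)) = z"
    unfolding d_def by (metis (mono_tags, lifting) LeastI_ex)+
  have d_min: "j = 0" if "j < d" "z ^ (q ^ (k * j)) = z" for j
    using that not_less_Least[of j "\<lambda>d. d > 0 \<and> z ^ (q ^ (k * d)) = z"] by (auto simp: d_def)
  have mod: "w ^ (q ^ (k * j)) = w ^ (q ^ (k * (j mod d)))" if "w \<in> ?O" for w j
  proof -
    have "w ^ (q ^ (k * d)) = w"
      using d(2) fixed_iff[OF that] by blast
    then have "w ^ (q ^ (k * d * (j div d))) = w"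
      by (rule frob_fixed_mult)
    moreover have "k * j = k * d * (j div d) + k * (j mod d)"
      by (metis distrib_left mult.assoc mult_div_mod_eq)
    ultimately show ?thesis
      by (simp only: frob_power_add)
  qed
  \<comment> \<open>Applying the map n times is the identity, so n mod d applications already fix z;
    minimality makes this remainder 0.\<close>
  have "z ^ (q ^ (k * (n mod d))) = z"
    using mod[OF ratio_class_self[OF z], of n] frob_fixed_mult[OF frob_n, of z k]
    by (simp add: mult.commute)
  then have "d dvd n"
    using d_min[of "n mod d"] d(1) by auto
  define orb where "orb = (\<lambda>w::'e. (\<lambda>j. w ^ (q ^ (k * j))) ` {..<d})"
  have orb_mem: "w ^ (q ^ (k * j)) \<in> orb w" if "w \<in> ?O" for w j
    unfolding orb_def using mod[OF that, of j] d(1) by (metis imageI lessThan_iff mod_less_divisor)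
  have card_orb: "card (orb w) = d" if w: "w \<in> ?O" for w
  proof -
    have "i = j" if eq: "w ^ (q ^ (k * i)) = w ^ (q ^ (k * j))" and "i \<le> j" "j < d" for i j
    proof -
      have "w ^ (q ^ (k * (j - i))) = w"
        using frob_diff[OF eq] \<open>i \<le> j\<close> by (simp add: diff_mult_distrib2)
      then have "z ^ (q ^ (k * (j - i))) = z"
        using fixed_iff[OF w] by blast
      then have "j - i = 0"
        using \<open>j < d\<close> by (intro d_min) auto
      with \<open>i \<le> j\<close> show ?thesis by simp
    qed
    then have "inj_on (\<lambda>j. w ^ (q ^ (k * j))) {..<d}"
      by (intro inj_onI) (metis lessThan_iff nle_le)
    then show ?thesis
      by (simp add: orb_def card_image)
  qed
  have orb_eq: "orb v = orb w" if w: "w \<in> ?O" and v: "v \<in> orb w" for v w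
  proof (rule card_subset_eq)
    obtain i where i: "v = w ^ (q ^ (k * i))"
      using v unfolding orb_def by blast
    have "v ^ (q ^ (k * j)) \<in> orb w" for j
      using orb_mem[OF w, of "i + j"] by (simp add: i frob_power_add distrib_left)
    then show "orb v \<subseteq> orb w"
      unfolding orb_def by blast
    show "card (orb v) = card (orb w)"
      using closed[OF w] i w by (simp add: card_orb)
  qed (simp add: orb_def)
  have orb_sub: "orb w \<subseteq> ?O" if "w \<in> ?O" for w
    using closed[OF that] unfolding orb_def by blast
  have "\<Union>(orb ` ?O) = ?O"
  proof
    show "?O \<subseteq> \<Union>(orb ` ?O)"
      using orb_mem[where j = 0] by fastforce
  qed (use orb_sub in blast)
  \<comment> \<open>The cycles are disjoint blocks of d elements covering the class.\<close>
  moreover have "d * card (orb ` ?O) = card (\<Union>(orb ` ?O))"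
  proof (rule card_partition)
    fix A B assume "A \<in> orb ` ?O" "B \<in> orb ` ?O" "A \<noteq> B"
    then show "A \<inter> B = {}"
      using orb_eq by blast
  qed (auto simp: card_orb)
  ultimately have "d dvd q * (q ^ 2 - 1)"
    using card_ratio_class[OF z] by (metis dvd_triv_left)
  with \<open>d dvd n\<close> have "d = 1"
    using coprime_n by (metis coprime_common_divisor_nat)
  with d(2) show ?thesis by simp
qed

section \<open>Two-dimensional subspaces as multiples of planes\<close>

interpretation E: vector_space "ext_scale emb"
  using emb_hom by (rule vector_space_ext_scale)

lemma span_pair: "E.span {y * z, y} = (*) y ` plane z"
proof -
  have "x \<in> E.span {y * z, y} \<longleftrightarrow> (\<exists>a b. x = y * (emb a * z + emb b))" for x
    by (auto simp: E.span_breakdown_eq E.span_empty ext_scale_def algebra_simps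
        eq_diff_eq diff_eq_eq)
  then show ?thesis
    by (auto simp: plane_def image_iff)
qed

text \<open>A basis {u, v} gives v times \<open>plane (u / v)\<close>, and independence keeps u / v
  outside F.\<close>

lemma grassmannian_2_eq:
  "grassmannian emb 2 = {(*) y ` plane z | y z. y \<noteq> 0 \<and> z \<notin> range emb}"
proof (intro equalityI subsetI)
  fix W assume "W \<in> grassmannian emb 2"
  then have W: "E.subspace W" "E.dim W = 2"
    by (auto simp: grassmannian_def)
  obtain B where B: "B \<subseteq> W" "E.independent B" "W \<subseteq> E.span B" "card B = E.dim W"
    by (rule E.basis_exists)
  then obtain u v where uv: "B = {u, v}" "u \<noteq> v"
    using W(2) by (auto simp: card_2_iff)
  have "v \<noteq> 0"
    using B(2) E.dependent_zero uv by blast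
  have "u / v \<notin> range emb"
  proof
    assume "u / v \<in> range emb"
    then obtain a where "u / v = emb a" by blast
    then have "u = ext_scale emb a v"
      using \<open>v \<noteq> 0\<close> by (simp add: ext_scale_def field_simps)
    then have "u \<in> E.span {v}"
      by (simp add: E.span_scale E.span_base)
    with B(2) uv show False
      by (simp add: E.independent_insert)
  qed
  moreover have "W = (*) v ` plane (u / v)"
    using E.span_subspace[OF B(1,3) W(1)] span_pair[of v "u / v"] \<open>v \<noteq> 0\<close> by (simp add: uv)
  ultimately show "W \<in> {(*) y ` plane z | y z. y \<noteq> 0 \<and> z \<notin> range emb}"
    using \<open>v \<noteq> 0\<close> by blast
next
  fix W assume "W \<in> {(*) y ` plane z | y z. y \<noteq> 0 \<and> z \<notin> range emb}"
  then obtain y z where yz: "y \<noteq> 0" "z \<notin> range emb" and W: "W = E.span {y * z, y}"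
    by (auto simp: span_pair)
  have "y * z \<notin> E.span {y}"
    using yz by (auto simp: E.span_breakdown_eq ext_scale_def)
  then have "E.independent {y * z, y}"
    using yz(1) by (simp add: E.independent_insert)
  moreover have "y * z \<noteq> y"
    using yz emb_1 by (metis mult_cancel_left2 rangeI)
  ultimately show "W \<in> grassmannian emb 2"
    by (simp add: grassmannian_def W E.dim_eq_card_independent E.subspace_span)
qed

lemma consecutive_span_eq:
  assumes "\<beta> i = \<beta> (i - 1) * z"
  shows "consecutive_span emb \<beta> i = (*) (\<beta> (i - 1)) ` plane z"
  unfolding consecutive_span_def assms by (rule span_pair)

section \<open>Powers of the generator of the unit quotient\<close>

text \<open>Equality of cosets in the quotient group yields the factor from F; natural exponents
  suffice because the quotient is finite.\<close>

lemma generator_powers: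
  assumes \<alpha>: "\<alpha> \<noteq> 0"
    and gen: "generate (unit_quotient emb) {unit_class emb \<alpha>} = carrier (unit_quotient emb)"
    and x: "x \<noteq> 0"
  shows "\<exists>f j. x = emb f * \<alpha> ^ j"
proof -
  let ?R = "ring_of_type_algebra :: 'e ring"
  let ?H = "emb ` (UNIV - {0})"
  have G: "carrier (mult_of ?R) = UNIV - {0}" "x \<otimes>\<^bsub>mult_of ?R\<^esub> y = x * y"
    "\<one>\<^bsub>mult_of ?R\<^esub> = 1" for x y
    by (simp_all add: ring_of_type_algebra_def mult_of_def)
  interpret G: group "mult_of ?R"
  proof (rule groupI, unfold G)
    fix x :: 'e assume "x \<in> UNIV - {0}"
    then show "\<exists>y\<in>UNIV - {0}. y * x = 1"
      by (intro bexI[of _ "inverse x"]) auto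
  qed (auto simp: mult.assoc)
  have inv: "inv\<^bsub>mult_of ?R\<^esub> x = inverse x" if "x \<noteq> 0" for x
    by (rule G.inv_equality) (use that in \<open>simp_all add: G del: carrier_mult_of mult_mult_of one_mult_of\<close>)
  have pow: "x [^]\<^bsub>mult_of ?R\<^esub> (j::nat) = x ^ j" for x j
    by (induction j) (simp_all add: G mult.commute del: mult_mult_of one_mult_of)
  have "comm_group (mult_of ?R)"
    by (rule G.group_comm_groupI) (simp add: G mult.commute del: carrier_mult_of mult_mult_of one_mult_of)
  moreover have "subgroup ?H (mult_of ?R)"
  proof (rule G.subgroupI)
    show "?H \<noteq> {}"
      using one_neq_zero by blast
  next
    fix a assume "a \<in> ?H"
    then show "inv\<^bsub>mult_of ?R\<^esub> a \<in> ?H"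
      by (auto simp: inv simp flip: emb_inverse)
  qed (auto simp: G simp flip: emb_mult simp del: carrier_mult_of mult_mult_of one_mult_of)
  ultimately interpret N: normal ?H "mult_of ?R"
    by (rule comm_group.subgroup_imp_normal)
  interpret Q: group "unit_quotient emb"
    unfolding unit_quotient_def by (rule N.factorgroup_is_group)
  have "unit_class emb \<in> hom (mult_of ?R) (unit_quotient emb)"
    unfolding unit_class_def unit_quotient_def by (rule N.r_coset_hom_Mod)
  then interpret h: group_hom "mult_of ?R" "unit_quotient emb" "unit_class emb"
    by unfold_locales
  have "unit_class emb x \<in> carrier (unit_quotient emb)"
    using x by (intro h.hom_closed) (simp add: G del: carrier_mult_of mult_mult_of one_mult_of)
  also have "\<dots> = {unit_class emb \<alpha> [^]\<^bsub>unit_quotient emb\<^esub> j | j. j \<in> (UNIV :: nat set)}"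
  proof (subst gen[symmetric], rule Q.generate_pow_on_finite_carrier)
    show "unit_class emb \<alpha> \<in> carrier (unit_quotient emb)"
      using \<alpha> by (intro h.hom_closed) (simp add: G del: carrier_mult_of mult_mult_of one_mult_of)
  qed simp
  finally obtain j :: nat where "unit_class emb x = unit_class emb \<alpha> [^]\<^bsub>unit_quotient emb\<^esub> j"
    by blast
  also have "\<dots> = unit_class emb (\<alpha> ^ j)"
    using h.hom_nat_pow[of \<alpha> j] \<alpha> by (simp add: G pow del: carrier_mult_of mult_mult_of one_mult_of)
  finally have "unit_class emb x = unit_class emb (\<alpha> ^ j)" .
  moreover have "x \<in> unit_class emb x"
    unfolding unit_class_def
    using x by (intro G.rcos_self N.subgroup_axioms) (simp add: G del: carrier_mult_of mult_mult_of one_mult_of)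
  ultimately have "x \<in> ?H #>\<^bsub>mult_of ?R\<^esub> (\<alpha> ^ j)"
    by (simp add: unit_class_def)
  then show ?thesis
    unfolding r_coset_def G by blast
qed

section \<open>Conjugates, their classes and their product\<close>

text \<open>Exponents matter only modulo n. Without the bound, closure under Frobenius is
  immediate.\<close>

lemma conjugates_eq: "conjugates q n (z :: 'e) = range (\<lambda>k. z ^ (q ^ k))"
proof -
  have "z ^ (q ^ k) = z ^ (q ^ (k mod n))" for k
  proof -
    have "z ^ (q ^ (n * (k div n) + k mod n)) = z ^ (q ^ (k mod n))"
      by (simp only: frob_power_add frob_fixed_mult[OF frob_n])
    then show ?thesis
      by simp
  qed
  moreover have "k mod n < n" for k
    using n_pos by simp
  ultimately show ?thesis
    unfolding conjugates_def by blast
qed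

lemma frobenius_orbit_eq: "frobenius_orbit emb q n z = ratio_class emb ` conjugates q n z"
  by (simp add: frobenius_orbit_def conjugates_def image_image)

lemma conjugates_not_in_F: "z \<notin> range emb \<Longrightarrow> y \<in> conjugates q n z \<Longrightarrow> y \<notin> range emb"
  using frob_not_in_F by (auto simp: conjugates_def)

text \<open>For a \<le> b, the conjugate with exponent b is a Frobenius image of the one with
  exponent a; by \<open>conjugate_in_ratio_class\<close> it can share its class only by being equal
  to it.\<close>

lemma inj_on_ratio_class_conjugates:
  assumes z: "z \<notin> range emb"
  shows "inj_on (ratio_class emb) (conjugates q n z)"
proof -
  have eq: "z ^ (q ^ a) = z ^ (q ^ b)"
    if "ratio_class emb (z ^ (q ^ a)) = ratio_class emb (z ^ (q ^ b))" "a \<le> b" for a b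
  proof -
    have b: "z ^ (q ^ b) = (z ^ (q ^ a)) ^ (q ^ (b - a))"
      using \<open>a \<le> b\<close> by (simp flip: frob_power_add)
    have "z ^ (q ^ b) \<in> ratio_class emb (z ^ (q ^ a))"
      using ratio_class_self[OF frob_not_in_F[OF z, of b]] that(1) by simp
    then show ?thesis
      using conjugate_in_ratio_class[OF frob_not_in_F[OF z, of a], of "b - a"] by (simp only: b)
  qed
  show ?thesis
  proof (rule inj_onI)
    fix x y assume "x \<in> conjugates q n z" "y \<in> conjugates q n z"
      and class_eq: "ratio_class emb x = ratio_class emb y"
    then obtain a b where ab: "x = z ^ (q ^ a)" "y = z ^ (q ^ b)"
      by (auto simp: conjugates_def)
    show "x = y"
      using eq[of a b] eq[of b a] class_eq linear[of a b] unfolding ab by argo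
  qed
qed

text \<open>The norm of \<open>z\<close> from the field it generates down to \<open>F\<close>.\<close>

lemma prod_conjugates_in_F: "\<Prod>(conjugates q n z) \<in> range emb"
proof -
  let ?C = "conjugates q n z"
  have fin: "finite ?C"
    by simp
  have inj: "inj_on (\<lambda>x. x ^ q) ?C"
    using frob_inj[of _ 1] by (auto intro!: inj_onI)
  have "(z ^ (q ^ k)) ^ q = z ^ (q ^ Suc k)" for k
    using frob_power_add[of z k 1] by simp
  then have "(\<lambda>x. x ^ q) ` ?C \<subseteq> ?C"
    unfolding conjugates_eq by blast
  \<comment> \<open>An injective self-map of a finite set is a permutation, so Frobenius only
    reorders the factors of the product.\<close>
  then have "(\<lambda>x. x ^ q) ` ?C = ?C"
    using endo_inj_surj[OF fin _ inj] by blast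
  then have "(\<Prod>x\<in>?C. x ^ q) = \<Prod>?C"
    using prod.reindex[OF inj, of "\<lambda>x. x"] by simp
  then show ?thesis
    by (simp add: in_F_iff prod_power_distrib)
qed

text \<open>A coincidence at exponents a < b < n means that the exponent b - a fixes z. It is
  coprime to the prime n, so Frobenius itself would fix z.\<close>

lemma card_conjugates_prime:
  assumes "prime n" and z: "z \<notin> range emb"
  shows "card (conjugates q n z) = n"
proof -
  have "a = b" if eq: "z ^ (q ^ a) = z ^ (q ^ b)" and "a \<le> b" "b < n" for a b
  proof (rule ccontr)
    assume "a \<noteq> b"
    then have "0 < b - a" "b - a < n"
      using that by auto
    then have "\<not> n dvd b - a"
      by (auto dest: dvd_imp_le)
    then have "coprime n (b - a)"
      using prime_imp_coprime \<open>prime n\<close> by blast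
    moreover have "z ^ (q ^ gcd n (b - a)) = z"
      using frob_diff[OF eq \<open>a \<le> b\<close>] frob_n by (intro frob_gcd)
    ultimately have "z ^ q = z"
      by simp
    with z show False
      using in_F_iff by blast
  qed
  then have "inj_on (\<lambda>k. z ^ (q ^ k)) {..<n}"
    by (intro inj_onI) (metis lessThan_iff nle_le)
  then show ?thesis
    by (simp add: conjugates_def card_image)
qed

section \<open>Equality of multiples of planes\<close>

lemma scale_plane: "f \<noteq> 0 \<Longrightarrow> (*) (emb f) ` plane z = plane z"
proof (intro equalityI subsetI)
  fix x assume "x \<in> plane z" and f: "f \<noteq> 0"
  then obtain a b where "x = emb a * z + emb b"
    by (blast elim: mem_planeE)
  then have "x = emb f * (emb (a / f) * z + emb (b / f))"
    using f by (simp add: distrib_left)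
  then show "x \<in> (*) (emb f) ` plane z"
    by blast
next
  fix x assume "x \<in> (*) (emb f) ` plane z"
  then obtain a b where "x = emb f * (emb a * z + emb b)"
    by (auto simp: plane_def)
  then have "x = emb (f * a) * z + emb (f * b)"
    by (simp add: distrib_left)
  then show "x \<in> plane z"
    by blast
qed

lemma multiple_of_plane_eq_imp_ratio_class_eq:
  assumes "y \<noteq> 0" "y' \<noteq> 0" "z \<notin> range emb" "z' \<notin> range emb"
    and eq: "(*) y ` plane z = (*) y' ` plane z'"
  shows "ratio_class emb z' = ratio_class emb z"
proof -
  have "plane z' = (*) (inverse y') ` (*) y' ` plane z'"
    using assms(2) by (simp add: image_image flip: mult.assoc)
  also have "\<dots> = (*) (inverse y') ` (*) y ` plane z"
    by (simp only: eq)
  also have "\<dots> = (*) (inverse y' * y) ` plane z"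
    by (simp add: image_image mult.assoc)
  finally have "z' \<in> ratio_class emb z"
    using assms by (intro ratio_classI[of _ _ "inverse y' * y"]) auto
  then show ?thesis
    using assms by (simp add: ratio_class_eq_iff)
qed

text \<open>Cancelling y leaves x in the stabilizer of \<open>plane z\<close>.\<close>

lemma multiple_of_plane_eq_imp_in_F:
  assumes "y \<noteq> 0" "z \<notin> range emb" and eq: "(*) (x * y) ` plane z = (*) y ` plane z"
  shows "x \<in> range emb"
proof -
  have "inverse y * (x * y * v) = x * v" for v
    using assms(1) by (simp add: field_simps)
  then have "(*) x ` plane z = (*) (inverse y) ` (*) (x * y) ` plane z"
    by (simp only: image_image)
  also have "\<dots> = (*) (inverse y) ` (*) y ` plane z"
    by (simp only: eq)
  also have "\<dots> = plane z"
    using assms(1) by (simp add: image_image flip: mult.assoc)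
  finally show ?thesis
    using assms(2) by (intro plane_stabilizer)
qed

text \<open>A Frobenius power fixing \<alpha> would fix all scalar multiples of powers of \<alpha>,
  hence all q^n elements of E, but it has at most q^k fixed points.\<close>

lemma generator_not_fixed:
  assumes gen: "\<And>x. x \<noteq> 0 \<Longrightarrow> \<exists>f j. x = emb f * \<alpha> ^ j" and "0 < k" "k < n"
  shows "\<alpha> ^ (q ^ k) \<noteq> \<alpha>"
proof
  assume \<alpha>: "\<alpha> ^ (q ^ k) = \<alpha>"
  have "x ^ (q ^ k) = x" for x :: 'e
  proof (cases "x = 0")
    case False
    then obtain f j where "x = emb f * \<alpha> ^ j"
      using gen by blast
    moreover have "(\<alpha> ^ j) ^ (q ^ k) = (\<alpha> ^ (q ^ k)) ^ j"
      by (simp add: mult.commute flip: power_mult)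
    ultimately show ?thesis
      by (simp only: power_mult_distrib frob_emb \<alpha>)
  qed (use q_gt_1 in simp)
  then have "CARD('e) = card {x::'e. x ^ (q ^ k) = x}"
    by simp
  also have "\<dots> \<le> q ^ k"
    using q_gt_1 \<open>0 < k\<close> by (intro card_power_fixed_points_le one_less_power)
  also have "\<dots> < q ^ n"
    using q_gt_1 \<open>k < n\<close> by simp
  finally show False
    by (simp add: card_E)
qed

section \<open>From class representatives to a universal cycle\<close>

text \<open>Write an index as a + s * r with a in {1..r}. The ratio class of the span determines a,
  and the block number s is an exponent of \<alpha>. With d the order of \<alpha> modulo scalars,
  the first r * d spans list every subspace once.\<close>

lemma universal_cycle_of_representatives:
  assumes \<alpha>: "\<alpha> \<noteq> 0" and gen: "\<And>x. x \<noteq> 0 \<Longrightarrow> \<exists>f j. x = emb f * \<alpha> ^ j"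
    and r: "r > 0"
    and c_not_in_F: "\<And>i. i \<in> {1..r} \<Longrightarrow> c i \<notin> range emb"
    and inj: "inj_on (\<lambda>i. ratio_class emb (c i)) {1..r}"
    and surj: "\<And>z. z \<notin> range emb \<Longrightarrow> \<exists>i\<in>{1..r}. ratio_class emb z = ratio_class emb (c i)"
    and periodic: "\<And>i. i \<ge> 1 \<Longrightarrow> c (i + r) = c i"
    and prod: "(\<Prod>i=1..r. c i) = emb f * \<alpha>"
    and \<beta>0: "\<beta> 0 = 1" and \<beta>: "\<And>i. i \<ge> 1 \<Longrightarrow> \<beta> i = (\<Prod>j=1..i. c j)"
  shows "universal_cycle emb \<beta>"
    and "\<And>i. i \<ge> 1 \<Longrightarrow> consecutive_span emb \<beta> (i + r) = (*) \<alpha> ` consecutive_span emb \<beta> i"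
proof -
  let ?W = "consecutive_span emb \<beta>"
  have c_add: "c (i + j * r) = c i" if "i \<ge> 1" for i j
  proof (induction j)
    case (Suc j)
    then show ?case
      using periodic[of "i + j * r"] that by (simp add: ac_simps)
  qed simp
  \<comment> \<open>Blocks start at index 1, so i - 1 is divided by r and the remainder shifted
    back.\<close>
  have split: "i = ((i - 1) mod r + 1) + ((i - 1) div r) * r" "(i - 1) mod r + 1 \<in> {1..r}"
    if "i \<ge> 1" for i
    using that r mod_less_divisor[OF r, of "i - 1"] by (auto simp: Suc_le_eq)
  have c_notin: "c i \<notin> range emb" if "i \<ge> 1" for i
    using split[OF that] c_add[of "(i - 1) mod r + 1" "(i - 1) div r"] c_not_in_F by simp
  then have c_nz: "c i \<noteq> 0" if "i \<ge> 1" for i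
    using that emb_0 by (metis rangeI)
  have \<beta>': "\<beta> i = (\<Prod>j=1..i. c j)" for i
    by (cases "i = 0") (auto simp: \<beta>0 \<beta>)
  have \<beta>_nz: "\<beta> i \<noteq> 0" for i
    using c_nz by (simp add: \<beta>')
  have \<beta>_Suc: "\<beta> (Suc i) = \<beta> i * c (Suc i)" for i
    by (simp add: \<beta>')
  have f: "f \<noteq> 0"
    using \<beta>_nz[of r] prod by (auto simp: \<beta>')
  have W: "?W i = (*) (\<beta> (i - 1)) ` plane (c i)" if "i \<ge> 1" for i
    using \<beta>_Suc[of "i - 1"] that by (intro consecutive_span_eq) simp
  \<comment> \<open>By periodicity a block of r multipliers has the same product wherever it starts;
    its scalar \<open>emb f\<close> does not affect planes.\<close>
  have \<beta>_add_r: "\<beta> (i + r) = emb f * \<alpha> * \<beta> i" for i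
  proof (induction i)
    case (Suc i)
    then show ?case
      using \<beta>_Suc[of "i + r"] periodic[of "Suc i"] by (simp add: \<beta>_Suc)
  qed (use prod in \<open>simp add: \<beta>'\<close>)
  have mult_plane: "(*) (emb h * x) ` plane z = (*) x ` plane z" if "h \<noteq> 0" for h x z
  proof -
    have "(*) (emb h * x) ` plane z = (*) x ` (*) (emb h) ` plane z"
      by (simp add: image_image mult.left_commute mult.assoc)
    then show ?thesis
      by (simp add: scale_plane[OF that])
  qed
  show W_add_r: "?W (i + r) = (*) \<alpha> ` ?W i" if "i \<ge> 1" for i
  proof -
    have "\<beta> (i + r - 1) = emb f * (\<alpha> * \<beta> (i - 1))"
      using \<beta>_add_r[of "i - 1"] that by (simp add: mult.assoc)
    then have "?W (i + r) = (*) (\<alpha> * \<beta> (i - 1)) ` plane (c i)"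
      using that by (simp add: W periodic mult_plane[OF f])
    then show ?thesis
      using that by (simp add: W image_image mult.assoc)
  qed
  have W_add: "?W (i + j * r) = (*) (\<alpha> ^ j) ` ?W i" if "i \<ge> 1" for i j
  proof (induction j)
    case (Suc j)
    then show ?case
      using W_add_r[of "i + j * r"] that by (simp add: ac_simps image_image)
  qed simp
  have W_add': "?W (i + j * r) = (*) (\<alpha> ^ j * \<beta> (i - 1)) ` plane (c i)" if "i \<ge> 1" for i j
    using W_add[OF that] W[OF that] by (simp add: image_image mult.assoc)

  \<comment> \<open>The order of \<alpha> modulo scalars. It exists because
    \<open>inverse \<alpha>\<close> is itself a scalar times a power of \<alpha>.\<close>
  define d where "d = (LEAST d. d > 0 \<and> \<alpha> ^ d \<in> range emb)"
  obtain h j where "inverse \<alpha> = emb h * \<alpha> ^ j"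
    using gen[of "inverse \<alpha>"] \<alpha> by auto
  then have "1 = emb h * \<alpha> ^ Suc j"
    using \<alpha> by (simp add: field_simps)
  then have "\<alpha> ^ Suc j = emb (inverse h)"
    using emb_inverse by (metis inverse_unique)
  then have "\<exists>d. d > 0 \<and> \<alpha> ^ d \<in> range emb"
    by (metis rangeI zero_less_Suc)
  then have d: "d > 0" "\<alpha> ^ d \<in> range emb"
    unfolding d_def by (metis (mono_tags, lifting) LeastI_ex)+
  have d_min: "j = 0" if "j < d" "\<alpha> ^ j \<in> range emb" for j
    using that not_less_Least[of j "\<lambda>d. d > 0 \<and> \<alpha> ^ d \<in> range emb"] by (auto simp: d_def)
  obtain e where e: "\<alpha> ^ d = emb e"
    using d(2) by blast
  then have "e \<noteq> 0"
    using \<alpha> by (metis emb_0 power_not_zero)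

  have "inj_on ?W {1..r * d}"
  proof (rule inj_onI)
    fix i i' assume i: "i \<in> {1..r * d}" and i': "i' \<in> {1..r * d}" and eq: "?W i = ?W i'"
    define a s a' s' where "a = (i - 1) mod r + 1" and "s = (i - 1) div r"
      and "a' = (i' - 1) mod r + 1" and "s' = (i' - 1) div r"
    have as: "i = a + s * r" "i' = a' + s' * r" "a \<in> {1..r}" "a' \<in> {1..r}"
      using split[of i] split[of i'] i i' by (simp_all add: a_def s_def a'_def s'_def)
    have lt: "s < d" "s' < d"
      using i i' r by (auto simp: s_def s'_def less_mult_imp_div_less mult.commute)
    have eq': "(*) (\<alpha> ^ s * \<beta> (a - 1)) ` plane (c a) = (*) (\<alpha> ^ s' * \<beta> (a' - 1)) ` plane (c a')"
      using eq W_add'[of a s] W_add'[of a' s'] as by simp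
    \<comment> \<open>Equal spans have equal classes, and a block contains each class once, so the
      positions within the blocks agree.\<close>
    then have "ratio_class emb (c a') = ratio_class emb (c a)"
      using \<alpha> \<beta>_nz c_not_in_F as(3,4)
      by (intro multiple_of_plane_eq_imp_ratio_class_eq[OF _ _ _ _ eq']) auto
    then have a: "a' = a"
      using inj as(3,4) by (auto dest: inj_onD)
    \<comment> \<open>At equal positions the quotient of the two factors stabilizes a plane, so
      \<alpha> ^ (u - t) lies in F, and u - t < d forces it to be 0.\<close>
    have "t = u" if "u < d" "t \<le> u"
      and "(*) (\<alpha> ^ t * \<beta> (a - 1)) ` plane (c a) = (*) (\<alpha> ^ u * \<beta> (a - 1)) ` plane (c a)" for t u
    proof -
      have "\<alpha> ^ u = \<alpha> ^ (u - t) * \<alpha> ^ t"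
        using \<open>t \<le> u\<close> by (simp flip: power_add)
      then have "(*) (\<alpha> ^ (u - t) * (\<alpha> ^ t * \<beta> (a - 1))) ` plane (c a)
          = (*) (\<alpha> ^ t * \<beta> (a - 1)) ` plane (c a)"
        using that(3) by (simp add: mult.assoc)
      then have "\<alpha> ^ (u - t) \<in> range emb"
        using \<alpha> \<beta>_nz c_not_in_F as(3) by (intro multiple_of_plane_eq_imp_in_F) auto
      then have "u - t = 0"
        using \<open>u < d\<close> by (intro d_min) auto
      with \<open>t \<le> u\<close> show "t = u" by simp
    qed
    from this[of s' s] this[of s s'] have "s = s'"
      using eq' lt unfolding a by (metis nle_le)
    with as a show "i = i'" by simp
  qed
  moreover have "?W ` {1..r * d} = grassmannian emb 2"
  proof (intro equalityI subsetI)
    fix V assume "V \<in> ?W ` {1..r * d}"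
    then obtain i where "i \<ge> 1" "V = (*) (\<beta> (i - 1)) ` plane (c i)"
      using W by auto
    then show "V \<in> grassmannian emb 2"
      using \<beta>_nz c_notin unfolding grassmannian_2_eq by blast
  next
    fix V assume "V \<in> grassmannian emb 2"
    then obtain y z where V: "V = (*) y ` plane z" and y: "y \<noteq> 0" and z: "z \<notin> range emb"
      by (auto simp: grassmannian_2_eq)
    obtain i where i: "i \<in> {1..r}" and "ratio_class emb z = ratio_class emb (c i)"
      using surj[OF z] by blast
    then have "z \<in> ratio_class emb (c i)"
      using ratio_class_self[OF z] by simp
    then obtain x where x: "x \<noteq> 0" "plane z = (*) x ` plane (c i)"
      using c_not_in_F[OF i] by (auto elim: ratio_classE)
    \<comment> \<open>V is y * x times \<open>plane (c i)\<close>. Dividing by the factor \<beta> (i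
      - 1) already present at index i leaves a power of \<alpha> up to a scalar; its exponent modulo
      d selects the block.\<close>
    obtain h j where hj: "y * x / \<beta> (i - 1) = emb h * \<alpha> ^ j"
      using gen[of "y * x / \<beta> (i - 1)"] y x(1) \<beta>_nz by auto
    have "\<alpha> ^ j = \<alpha> ^ (d * (j div d) + j mod d)"
      by simp
    also have "\<dots> = emb (e ^ (j div d)) * \<alpha> ^ (j mod d)"
      by (simp only: power_add power_mult e emb_power)
    finally have "y * x = emb (h * e ^ (j div d)) * (\<alpha> ^ (j mod d) * \<beta> (i - 1))"
      using hj \<beta>_nz[of "i - 1"] by (simp add: field_simps)
    then obtain u where u: "y * x = emb u * (\<alpha> ^ (j mod d) * \<beta> (i - 1))"
      by blast
    then have "u \<noteq> 0"
      using y x(1) by (metis emb_0 mult_eq_0_iff)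
    have "V = (*) (y * x) ` plane (c i)"
      by (simp add: V x(2) image_image mult.assoc)
    also have "\<dots> = ?W (i + (j mod d) * r)"
      using W_add'[of i "j mod d"] i by (simp add: u mult_plane[OF \<open>u \<noteq> 0\<close>])
    finally have "V = ?W (i + (j mod d) * r)" .
    moreover have "i + (j mod d) * r \<in> {1..r * d}"
    proof -
      have "Suc (j mod d) * r \<le> d * r"
        using d(1) by (intro mult_le_mono1) (simp add: Suc_leI)
      then show ?thesis
        using i by (simp add: mult.commute)
    qed
    ultimately show "V \<in> ?W ` {1..r * d}"
      by blast
  qed
  ultimately have bij: "bij_betw ?W {1..r * d} (grassmannian emb 2)"
    by (simp add: bij_betw_def)
  then have card: "card (grassmannian emb 2) = r * d"
    using bij_betw_same_card by fastforce
  \<comment> \<open>Advancing by d blocks multiplies by \<alpha> ^ d, a scalar.\<close>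
  have "?W (i + r * d) = ?W i" if "i \<ge> 1" for i
    unfolding mult.commute[of r d] W_add'[OF that] W[OF that] e mult_plane[OF \<open>e \<noteq> 0\<close>] ..
  with bij show "universal_cycle emb \<beta>"
    by (simp add: universal_cycle_def card Let_def)
qed

end

text \<open>Replacing g 1 by \<alpha> * g 1 keeps its ratio class but turns the product of all
  multipliers from an element of F into a scalar multiple of \<alpha>. The count r = m * n is
  asserted for prime n, since elements of proper intermediate fields have fewer than n
  conjugates.\<close>

theorem theorem1:
  fixes emb :: "'f::{field,finite} \<Rightarrow> 'e::{field,finite}"
    and q n m r :: nat
    and \<alpha> :: 'e
    and g c \<beta> :: "nat \<Rightarrow> 'e"
  assumes "primepow q" and "odd n" and "coprime n (q * (q ^ 2 - 1))"
    and "CARD('f) = q" and "CARD('e) = q ^ n"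
    and "emb \<in> ring_hom ring_of_type_algebra ring_of_type_algebra"
    and "\<alpha> \<noteq> 0"
    and "generate (unit_quotient emb) {unit_class emb \<alpha>} = carrier (unit_quotient emb)"
    and "m \<ge> 1"
    and "\<And>i. i \<in> {1..m} \<Longrightarrow> g i \<notin> range emb"
    and "(\<Union>i\<in>{1..m}. frobenius_orbit emb q n (g i)) = ratio_classes emb"
    and "disjoint_family_on (\<lambda>i. frobenius_orbit emb q n (g i)) {1..m}"
    and "\<exists>\<gamma>\<in>carrier PGL2. \<alpha> * g 1 = pgl_act emb \<gamma> (g 1)"
    and "bij_betw c {1..r}
           ({\<alpha> * g 1} \<union> (\<lambda>k. g 1 ^ (q ^ k)) ` {1..<n} \<union> (\<Union>i\<in>{2..m}. conjugates q n (g i)))"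
    and "\<And>i. i \<ge> 1 \<Longrightarrow> c (i + r) = c i"
    and "\<beta> 0 = 1"
    and "\<And>i. i \<ge> 1 \<Longrightarrow> \<beta> i = (\<Prod>j=1..i. c j)"
  shows "universal_cycle emb \<beta>
    \<and> (\<forall>i\<ge>1. consecutive_span emb \<beta> (i + r) = (\<lambda>w. \<alpha> * w) ` consecutive_span emb \<beta> i)
    \<and> (prime n \<longrightarrow> r = m * n)"
proof -
  interpret finite_field_ext emb q n
    by unfold_locales (fact assms)+
  note \<alpha> = assms(7) and gen = generator_powers[OF assms(7,8)]
  \<comment> \<open>Groups the multipliers by Frobenius orbit, so that only \<open>C 1\<close>
    deviates from a set of conjugates.\<close>
  define C where "C = (\<lambda>i. if i = 1 then insert (\<alpha> * g 1) ((\<lambda>k. g 1 ^ (q ^ k)) ` {1..<n})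
    else conjugates q n (g i))"
  define S where "S = (\<Union>i\<in>{1..m}. C i)"
  have one: "1 \<in> {1..m}"
    using assms(9) by simp
  have g: "g i \<notin> range emb" if "i \<in> {1..m}" for i
    using assms(10) that .
  have g1: "g 1 \<notin> range emb"
    using g one by blast
  have \<alpha>g1: "\<alpha> * g 1 \<in> ratio_class emb (g 1)"
    using assms(13) by (auto simp: ratio_class_def orbit_def)
  have \<alpha>g1_notin: "\<alpha> * g 1 \<notin> range emb"
    using g1 \<alpha>g1 by (rule ratio_classE)
  have \<alpha>g1_class: "ratio_class emb (\<alpha> * g 1) = ratio_class emb (g 1)"
    using \<alpha>g1 ratio_class_eq_iff[OF g1 \<alpha>g1_notin] by blast
  have g1_nz: "g 1 \<noteq> 0"
    using g1 emb_0 by (metis rangeI)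

  \<comment> \<open>A Frobenius power fixing g 1 also fixes \<alpha> * g 1, which has the same
    class, and hence their quotient \<alpha>. So leaving out the exponent 0 really removes g
    1.\<close>
  have g1_conj: "g 1 ^ (q ^ k) \<noteq> g 1" if "0 < k" "k < n" for k
  proof
    assume fixed: "g 1 ^ (q ^ k) = g 1"
    then have "(\<alpha> * g 1) ^ (q ^ k) = \<alpha> * g 1"
      using frob_fixes_ratio_class[OF \<alpha>g1] by blast
    then have "\<alpha> ^ (q ^ k) = \<alpha>"
      using fixed g1_nz by (simp add: power_mult_distrib)
    then show False
      using generator_not_fixed[OF gen that] by blast
  qed
  define R where "R = (\<lambda>k. g 1 ^ (q ^ k)) ` {1..<n}"
  have "{..<n} = insert 0 {1..<n}"
    using n_pos by auto
  then have conj_g1: "conjugates q n (g 1) = insert (g 1) R"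
    by (simp add: conjugates_def R_def)
  have g1_R: "g 1 \<notin> R"
  proof
    assume "g 1 \<in> R"
    then obtain k where k: "g 1 = g 1 ^ (q ^ k)" "k \<in> {1..<n}"
      unfolding R_def by (rule imageE)
    have "g 1 ^ (q ^ k) \<noteq> g 1"
      using k(2) by (intro g1_conj) auto
    then show False
      using k(1)[symmetric] by contradiction
  qed
  \<comment> \<open>Hence adjoining \<alpha> * g 1 to \<open>R\<close> repeats neither an element
    nor a class.\<close>
  have class_R: "ratio_class emb (g 1) \<notin> ratio_class emb ` R"
    using inj_on_ratio_class_conjugates[OF g1] g1_R unfolding conj_g1 by auto
  have \<alpha>g1_R: "\<alpha> * g 1 \<notin> R"
    using class_R \<alpha>g1_class by (metis imageI)
  have C1: "C 1 = insert (\<alpha> * g 1) R"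
    by (simp add: C_def R_def)
  have C_other: "C i = conjugates q n (g i)" if "i \<noteq> 1" for i
    using that by (simp add: C_def)
  have fin: "finite (C i)" for i
    by simp

  have class_C: "ratio_class emb ` C i = frobenius_orbit emb q n (g i)" for i
  proof (cases "i = 1")
    case True
    then show ?thesis
      by (simp only: C1 frobenius_orbit_eq conj_g1 image_insert \<alpha>g1_class)
  qed (simp only: C_other frobenius_orbit_eq not_False_eq_True)
  have inj_C: "inj_on (ratio_class emb) (C i)" if "i \<in> {1..m}" for i
  proof (cases "i = 1")
    case True
    show ?thesis
      using inj_on_ratio_class_conjugates[OF g1] class_R
      unfolding True C1 conj_g1 inj_on_insert \<alpha>g1_class by blast
  next
    case False
    then show ?thesis
      using inj_on_ratio_class_conjugates[OF g[OF that]] by (simp only: C_other not_False_eq_True)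
  qed
  have C_notin: "x \<notin> range emb" if "i \<in> {1..m}" "x \<in> C i" for i x
  proof (cases "i = 1")
    case True
    have "x = \<alpha> * g 1 \<or> x \<in> conjugates q n (g 1)"
      using that(2) unfolding True C1 conj_g1 insert_iff by argo
    then show ?thesis
      using \<alpha>g1_notin conjugates_not_in_F[OF g1] by metis
  next
    case False
    then show ?thesis
      using that(2) conjugates_not_in_F[OF g[OF that(1)]] by (simp only: C_other not_False_eq_True)
  qed
  have disj: "C i \<inter> C j = {}" if "i \<in> {1..m}" "j \<in> {1..m}" "i \<noteq> j" for i j
  proof -
    have "ratio_class emb ` C i \<inter> ratio_class emb ` C j = {}"
      unfolding class_C using assms(12) that by (rule disjoint_family_onD)
    then show ?thesis by blast
  qed
  have inj_S: "inj_on (ratio_class emb) S"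
  proof (rule inj_onI)
    fix x y assume "x \<in> S" "y \<in> S" and eq: "ratio_class emb x = ratio_class emb y"
    then obtain i j where ij: "i \<in> {1..m}" "j \<in> {1..m}" "x \<in> C i" "y \<in> C j"
      by (auto simp: S_def)
    have "ratio_class emb x \<in> frobenius_orbit emb q n (g i) \<inter> frobenius_orbit emb q n (g j)"
      using ij eq by (metis IntI class_C imageI)
    then have "i = j"
      using disjoint_family_onD[OF assms(12) ij(1,2)] by blast
    with ij show "x = y"
      using inj_onD[OF inj_C[OF ij(1)] eq] by simp
  qed
  have class_S: "ratio_class emb ` S = ratio_classes emb"
    by (simp only: S_def image_UN class_C assms(11))

  have "S = {\<alpha> * g 1} \<union> (\<lambda>k. g 1 ^ (q ^ k)) ` {1..<n} \<union> (\<Union>i\<in>{2..m}. conjugates q n (g i))"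
  proof -
    have "{1..m} = insert 1 {2..m}"
      using one by auto
    then have "S = C 1 \<union> (\<Union>i\<in>{2..m}. C i)"
      by (simp only: S_def UN_insert)
    also have "(\<Union>i\<in>{2..m}. C i) = (\<Union>i\<in>{2..m}. conjugates q n (g i))"
      by (intro SUP_cong refl C_other) simp
    finally show ?thesis
      by (simp only: C1 R_def Un_insert_left Un_empty_left)
  qed
  with assms(14) have bij: "bij_betw c {1..r} S"
    by simp

  have "\<exists>h. \<Prod>(conjugates q n (g i)) = emb h" for i
    using prod_conjugates_in_F by blast
  then obtain h where h: "\<And>i. \<Prod>(conjugates q n (g i)) = emb (h i)"
    by metis
  \<comment> \<open>The conjugates of each g i have their product in F; exchanging g 1 for \<alpha>
    * g 1 adds the single factor \<alpha>.\<close>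
  have prod_C: "\<Prod>(C i) = (if i = 1 then \<alpha> else 1) * emb (h i)" for i
  proof (cases "i = 1")
    case True
    have "\<Prod>(C 1) = \<alpha> * \<Prod>(conjugates q n (g 1))"
      unfolding C1 conj_g1 using \<alpha>g1_R g1_R by simp
    then show ?thesis
      by (simp only: True h refl if_True)
  qed (simp add: C_other h)
  have "(\<Prod>i=1..r. c i) = \<Prod>S"
    using prod.reindex_bij_betw[OF bij, of "\<lambda>x. x"] .
  also have "\<dots> = (\<Prod>i=1..m. \<Prod>(C i))"
    unfolding S_def using fin disj by (subst prod.UNION_disjoint) auto
  also have "\<dots> = (\<Prod>i=1..m. if i = 1 then \<alpha> else 1) * (\<Prod>i=1..m. emb (h i))"
    by (simp only: prod_C prod.distrib)
  also have "(\<Prod>i=1..m. if i = 1 then \<alpha> else 1) = \<alpha>"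
    using one by (simp add: prod.delta)
  also have "(\<Prod>i=1..m. emb (h i)) = emb (\<Prod>i=1..m. h i)"
    by (induction m) simp_all
  finally have prod: "(\<Prod>i=1..r. c i) = emb (\<Prod>i=1..m. h i) * \<alpha>"
    by (simp only: mult.commute)

  have "\<alpha> * g 1 \<in> S"
    using one C1 by (auto simp: S_def)
  then have r: "r > 0"
    using bij by (cases r) (auto simp: bij_betw_def)
  have c_S: "c ` {1..r} = S" and c_inj: "inj_on c {1..r}"
    using bij by (simp_all add: bij_betw_def)
  have c_notin: "c i \<notin> range emb" if "i \<in> {1..r}" for i
    using C_notin c_S that unfolding S_def by blast
  have inj: "inj_on (\<lambda>i. ratio_class emb (c i)) {1..r}"
    using comp_inj_on[OF c_inj inj_S[folded c_S]] by (simp only: comp_def)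
  have surj: "\<exists>i\<in>{1..r}. ratio_class emb z = ratio_class emb (c i)" if "z \<notin> range emb" for z
  proof -
    have "ratio_class emb z \<in> ratio_class emb ` c ` {1..r}"
      using that unfolding c_S class_S ratio_classes_def orbits_def ratio_class_def by blast
    then show ?thesis by blast
  qed
  note cycle = universal_cycle_of_representatives[OF \<alpha> gen r c_notin inj surj assms(15) prod
      assms(16,17)]

  have "r = m * n" if "prime n"
  proof -
    \<comment> \<open>\<open>C i\<close> and the conjugates of g i map injectively onto the same set
      of classes, so they have equal size.\<close>
    have card_C: "card (C i) = n" if "i \<in> {1..m}" for i
      using card_image[OF inj_C[OF that]] card_image[OF inj_on_ratio_class_conjugates[OF g[OF that]]]
        card_conjugates_prime[OF \<open>prime n\<close> g[OF that]]
      by (simp only: class_C frobenius_orbit_eq)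
    have "r = card S"
      using bij_betw_same_card[OF bij] by simp
    also have "\<dots> = (\<Sum>i\<in>{1..m}. card (C i))"
      unfolding S_def using fin disj by (intro card_UN_disjoint) auto
    also have "\<dots> = m * n"
      using card_C by simp
    finally show ?thesis .
  qed
  with cycle show ?thesis
    by blast
qed

end
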